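(* Let $(X,d_X)$ and $(Y,d_Y)$ be $g$-quasi metric spaces of the same index $r$, and let $d_{XY}$ be the product $g$-quasi metric on $X\times Y$. Then $(X\times Y,d_{XY})$ is $G$-complete if and only if both $(X,d_X)$ and $(Y,d_Y)$ are $G$-complete.
   Context: A $g$-quasi metric of index $r\ge 0$ on a nonempty set $X$ is a mapping $d:X\times X\to\mathbb R$ such that (a) for all $x,y\in X$, $d(x,y)\ge r$, and $d(x,y)=r\iff x=y$; (b) for all $x,y,z\in X$, $d(x,y)\le d(x,z)+d(z,y)$. (Symmetry is not assumed.) The pair $(X,d)$ is then a $g$-quasi metric space of index $r$. For $x\in X$ and $p>0$ let $B_d(x,p)=\{y\in X: d(x,y)<p\}$. The induced generalized topology $\mu(d)$ is the collection of all unions of members of $\{B_d(x,p):x\in X,\ p>0\}\cup\{\emptyset\}$ (it need not be closed under finite intersections). For $g$-quasi metric spaces $(X,d_X)$, $(Y,d_Y)$ of the same index $r$, the product $g$-quasi metric $d_{XY}$ on $X\times Y$ (again of index $r$) is $d_{XY}((x_1,y_1),(x_2,y_2))=\max\{d_X(x_1,x_2),d_Y(y_1,y_2)\}$. A sequence $(x_n)$ in $(X,d)$ converges to $c\in X$ if it does so in $(X,\mu(d))$, i.e. for every $V\in\mu(d)$ with $c\in V$ there is $k\in\mathbb N$ with $x_n\in V$ for all $n\ge k$. A sequence $(x_n)$ in a $g$-quasi metric space $(X,d)$ of index $r$ is $G$-Cauchy if for every $\epsilon>r$ there exists $k\in\mathbb N$ such that $d(x_n,x_{n+1})<\epsilon$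 for all $n\ge k$. $(X,d)$ is $G$-complete if every $G$-Cauchy sequence in it converges to some point of $X$. *)

theory Defs
  imports Complex_Main
begin

text \<open>
  The spaces are carrier sets \<open>X\<close> inside a type; a map \<open>d : X \<times> X \<rightarrow> \<real>\<close> is represented by a curried
  total function of which only the values on \<open>X\<close> matter.
\<close>

definition g_quasi_metric :: "'a set \<Rightarrow> ('a \<Rightarrow> 'a \<Rightarrow> real) \<Rightarrow> real \<Rightarrow> bool" where
  "g_quasi_metric X d r \<longleftrightarrow>
     X \<noteq> {} \<and> r \<ge> 0 \<and>
     (\<forall>x\<in>X. \<forall>y\<in>X. d x y \<ge> r \<and> (d x y = r \<longleftrightarrow> x = y)) \<and>
     (\<forall>x\<in>X. \<forall>y\<in>X. \<forall>z\<in>X. d x y \<le> d x z + d z y)"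

definition gq_ball :: "'a set \<Rightarrow> ('a \<Rightarrow> 'a \<Rightarrow> real) \<Rightarrow> 'a \<Rightarrow> real \<Rightarrow> 'a set" where
  "gq_ball X d x p = {y \<in> X. d x y < p}"

text \<open>
  Not a topology in general: it need not be closed under finite intersections, so the library
  type \<open>topology\<close> and its notion of limit do not apply. Note also that the ball containing a given
  point need not be centred at that point.
\<close>

definition gq_topology :: "'a set \<Rightarrow> ('a \<Rightarrow> 'a \<Rightarrow> real) \<Rightarrow> 'a set set" where
  "gq_topology X d =
     {\<Union>\<U> | \<U>. \<U> \<subseteq> {gq_ball X d x p | x p. x \<in> X \<and> p > 0} \<union> {{}}}"

definition gq_converges :: "'a set \<Rightarrow> ('a \<Rightarrow> 'a \<Rightarrow> real) \<Rightarrow> (nat \<Rightarrow> 'a) \<Rightarrow> 'a \<Rightarrow> bool" where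
  "gq_converges X d s c \<longleftrightarrow>
     c \<in> X \<and> (\<forall>V \<in> gq_topology X d. c \<in> V \<longrightarrow> (\<exists>k. \<forall>n\<ge>k. s n \<in> V))"

definition G_Cauchy :: "('a \<Rightarrow> 'a \<Rightarrow> real) \<Rightarrow> real \<Rightarrow> (nat \<Rightarrow> 'a) \<Rightarrow> bool" where
  "G_Cauchy d r s \<longleftrightarrow> (\<forall>\<epsilon>>r. \<exists>k. \<forall>n\<ge>k. d (s n) (s (Suc n)) < \<epsilon>)"

definition G_complete :: "'a set \<Rightarrow> ('a \<Rightarrow> 'a \<Rightarrow> real) \<Rightarrow> real \<Rightarrow> bool" where
  "G_complete X d r \<longleftrightarrow>
     (\<forall>s. (\<forall>n. s n \<in> X) \<longrightarrow> G_Cauchy d r s \<longrightarrow> (\<exists>c\<in>X. gq_converges X d s c))"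

definition prod_gq_metric ::
  "('a \<Rightarrow> 'a \<Rightarrow> real) \<Rightarrow> ('b \<Rightarrow> 'b \<Rightarrow> real) \<Rightarrow> 'a \<times> 'b \<Rightarrow> 'a \<times> 'b \<Rightarrow> real" where
  "prod_gq_metric dX dY u v = max (dX (fst u) (fst v)) (dY (snd u) (snd v))"

lemma g_quasi_metric_prod:
  assumes "g_quasi_metric X dX r" and "g_quasi_metric Y dY r"
  shows "g_quasi_metric (X \<times> Y) (prod_gq_metric dX dY) r"
proof -
  have ge: "r \<le> dX x x'" and eq: "dX x x' = r \<longleftrightarrow> x = x'" if "x \<in> X" "x' \<in> X" for x x'
    using assms(1) that by (simp_all add: g_quasi_metric_def)
  have ge': "r \<le> dY y y'" and eq': "dY y y' = r \<longleftrightarrow> y = y'" if "y \<in> Y" "y' \<in> Y" for y y'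
    using assms(2) that by (simp_all add: g_quasi_metric_def)
  have tri: "dX x x' \<le> dX x z + dX z x'" if "x \<in> X" "x' \<in> X" "z \<in> X" for x x' z
    using assms(1) that by (simp add: g_quasi_metric_def)
  have tri': "dY y y' \<le> dY y z + dY z y'" if "y \<in> Y" "y' \<in> Y" "z \<in> Y" for y y' z
    using assms(2) that by (simp add: g_quasi_metric_def)
  have "r \<le> prod_gq_metric dX dY u v \<and> (prod_gq_metric dX dY u v = r \<longleftrightarrow> u = v)"
    if "u \<in> X \<times> Y" "v \<in> X \<times> Y" for u v
  proof -
    have "fst u \<in> X" "snd u \<in> Y" "fst v \<in> X" "snd v \<in> Y"
      using that by auto
    then show ?thesis
      using ge[of "fst u" "fst v"] eq[of "fst u" "fst v"] ge'[of "snd u" "snd v"] eq'[of "snd u" "snd v"]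
      unfolding prod_gq_metric_def prod_eq_iff by linarith
  qed
  moreover have "prod_gq_metric dX dY u v \<le> prod_gq_metric dX dY u w + prod_gq_metric dX dY w v"
    if "u \<in> X \<times> Y" "v \<in> X \<times> Y" "w \<in> X \<times> Y" for u v w
  proof -
    have "fst u \<in> X" "snd u \<in> Y" "fst v \<in> X" "snd v \<in> Y" "fst w \<in> X" "snd w \<in> Y"
      using that by auto
    then show ?thesis
      using tri[of "fst u" "fst v" "fst w"] tri'[of "snd u" "snd v" "snd w"]
      unfolding prod_gq_metric_def by linarith
  qed
  moreover have "X \<times> Y \<noteq> {}" "r \<ge> 0"
    using assms by (simp_all add: g_quasi_metric_def)
  ultimately show ?thesis
    unfolding g_quasi_metric_def by simp
qed

end

theory Submission
  imports Defs
begin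

text \<open>
  A ball of the product with centre \<open>(x, y)\<close> and radius \<open>p\<close> is the product of the balls of radius
  \<open>p\<close> about \<open>x\<close> and \<open>y\<close>. Hence both notions in the definition of completeness can be read off
  coordinatewise: a sequence of pairs is Cauchy iff both coordinate sequences are
  (\<open>G_Cauchy_prod_iff\<close>), and it converges to \<open>(a, b)\<close> iff its coordinates converge to \<open>a\<close> and
  \<open>b\<close> (\<open>gq_converges_prod_iff\<close>). If both factors are complete, a Cauchy sequence of pairs therefore
  converges in each coordinate. Conversely, a Cauchy sequence in one factor, paired with a constant
  sequence in the other, is Cauchy in the product, and the corresponding coordinate of its limit
  there is a limit in the factor.

  The delicate point is that a generalized topology need not be closed under intersections and that the
  balls about a point need not form a base of its neighbourhoods: balls with every possible centre
  have to be tested. A ball about \<open>x\<close> containing \<open>a\<close> is tested in the product by a ball of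
  the same radius about \<open>(x, b)\<close>. This contains \<open>(a, b)\<close> because the radius exceeds
  \<open>dX x a \<ge> r = dY b b\<close>; this is where the common index enters.
\<close>

text \<open>
  Every open set is a union of balls, so a neighbourhood of the limit contains a ball that contains
  the limit, though not necessarily as its centre.
\<close>

lemma gq_converges_iff_balls:
  "gq_converges X d s c \<longleftrightarrow>
     c \<in> X \<and> (\<forall>x\<in>X. \<forall>p>0. d x c < p \<longrightarrow> (\<forall>\<^sub>F n in sequentially. s n \<in> X \<and> d x (s n) < p))"
  (is "_ \<longleftrightarrow> c \<in> X \<and> ?balls")
proof -
  have "?balls" if conv: "gq_converges X d s c"
  proof (intro ballI allI impI)
    fix x p assume x: "x \<in> X" "(0::real) < p" and c: "d x c < p"
    have "gq_ball X d x p = \<Union>{gq_ball X d x p}"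
      by simp
    then have "gq_ball X d x p \<in> gq_topology X d"
      unfolding gq_topology_def using x by blast
    moreover have "c \<in> gq_ball X d x p"
      using conv c by (simp add: gq_converges_def gq_ball_def)
    ultimately have "\<exists>k. \<forall>n\<ge>k. s n \<in> gq_ball X d x p"
      using conv unfolding gq_converges_def by blast
    then show "\<forall>\<^sub>F n in sequentially. s n \<in> X \<and> d x (s n) < p"
      by (simp add: gq_ball_def eventually_sequentially)
  qed
  moreover have "\<exists>k. \<forall>n\<ge>k. s n \<in> V"
    if cX: "c \<in> X" and balls: "?balls" and V: "V \<in> gq_topology X d" and cV: "c \<in> V" for V
  proof -
    obtain x p where x: "x \<in> X" "p > 0" and sub: "gq_ball X d x p \<subseteq> V"
      and c: "c \<in> gq_ball X d x p"
      using V cV unfolding gq_topology_def by blast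
    have "\<forall>\<^sub>F n in sequentially. s n \<in> X \<and> d x (s n) < p"
      using balls x c by (simp add: gq_ball_def)
    then have "\<forall>\<^sub>F n in sequentially. s n \<in> V"
      by eventually_elim (use sub in \<open>auto simp: gq_ball_def\<close>)
    then show ?thesis
      by (simp add: eventually_sequentially)
  qed
  ultimately show ?thesis
    unfolding gq_converges_def by blast
qed

lemma G_Cauchy_iff_eventually:
  "G_Cauchy d r s \<longleftrightarrow> (\<forall>\<epsilon>>r. \<forall>\<^sub>F n in sequentially. d (s n) (s (Suc n)) < \<epsilon>)"
  by (simp add: G_Cauchy_def eventually_sequentially)

lemma G_Cauchy_prod_iff:
  "G_Cauchy (prod_gq_metric dX dY) r (\<lambda>n. (s n, t n)) \<longleftrightarrow> G_Cauchy dX r s \<and> G_Cauchy dY r t"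
  by (auto simp: G_Cauchy_iff_eventually prod_gq_metric_def eventually_conj_iff)

lemma G_Cauchy_const:
  assumes "g_quasi_metric X d r" and "c \<in> X"
  shows "G_Cauchy d r (\<lambda>n. c)"
  using assms by (auto simp: G_Cauchy_def g_quasi_metric_def)

text \<open>
  The only real step is from the product to a factor: the coordinate that is not tested must meet
  the same radius \<open>p\<close> as the tested one, and taking its limit as the centre makes its distance
  the smallest one possible, the index \<open>r\<close>.
\<close>

lemma gq_converges_prod_iff:
  assumes X: "g_quasi_metric X dX r" and Y: "g_quasi_metric Y dY r"
  shows "gq_converges (X \<times> Y) (prod_gq_metric dX dY) (\<lambda>n. (s n, t n)) (a, b) \<longleftrightarrow>
         gq_converges X dX s a \<and> gq_converges Y dY t b" (is "?prod \<longleftrightarrow> ?factors")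
proof
  assume conv: ?prod
  then have ab: "a \<in> X" "b \<in> Y"
    by (auto simp: gq_converges_def)
  have self: "dX a a = r" "dY b b = r"
    using X Y ab by (auto simp: g_quasi_metric_def)
  have box: "\<forall>\<^sub>F n in sequentially. (s n \<in> X \<and> dX x (s n) < p) \<and> (t n \<in> Y \<and> dY y (t n) < p)"
    if "x \<in> X" "y \<in> Y" "p > 0" "dX x a < p" "dY y b < p" for x y p
  proof -
    have "(x, y) \<in> X \<times> Y" "prod_gq_metric dX dY (x, y) (a, b) < p"
      using that by (simp_all add: prod_gq_metric_def)
    then have "\<forall>\<^sub>F n in sequentially.
        (s n, t n) \<in> X \<times> Y \<and> prod_gq_metric dX dY (x, y) (s n, t n) < p"
      using conv \<open>p > 0\<close> unfolding gq_converges_iff_balls by blast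
    then show ?thesis
      by eventually_elim (simp add: prod_gq_metric_def)
  qed
  have "\<forall>\<^sub>F n in sequentially. s n \<in> X \<and> dX x (s n) < p"
    if "x \<in> X" "p > 0" "dX x a < p" for x p
  proof -
    have "r \<le> dX x a"
      using X ab that by (auto simp: g_quasi_metric_def)
    then show ?thesis
      using box[of x b p] that ab self by (simp add: eventually_conj_iff)
  qed
  moreover have "\<forall>\<^sub>F n in sequentially. t n \<in> Y \<and> dY y (t n) < p"
    if "y \<in> Y" "p > 0" "dY y b < p" for y p
  proof -
    have "r \<le> dY y b"
      using Y ab that by (auto simp: g_quasi_metric_def)
    then show ?thesis
      using box[of a y p] that ab self by (simp add: eventually_conj_iff)
  qed
  ultimately show ?factors
    using ab by (simp add: gq_converges_iff_balls)
next
  assume ?factors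
  then show ?prod
    by (auto simp: gq_converges_iff_balls prod_gq_metric_def eventually_conj_iff)
qed

lemma G_complete_iff:
  "G_complete X d r \<longleftrightarrow>
     (\<forall>s. (\<forall>n. s n \<in> X) \<longrightarrow> G_Cauchy d r s \<longrightarrow> (\<exists>c. gq_converges X d s c))"
proof -
  have "(\<exists>c\<in>X. gq_converges X d s c) \<longleftrightarrow> (\<exists>c. gq_converges X d s c)" for s
    by (auto simp: gq_converges_def)
  then show ?thesis
    by (simp only: G_complete_def)
qed

lemma G_completeE:
  assumes "G_complete X d r" and "\<And>n. s n \<in> X" and "G_Cauchy d r s"
  obtains c where "gq_converges X d s c"
  using assms by (auto simp only: G_complete_iff)

theorem theorem5p10:
  fixes X :: "'a set" and Y :: "'b set"
    and dX :: "'a \<Rightarrow> 'a \<Rightarrow> real" and dY :: "'b \<Rightarrow> 'b \<Rightarrow> real" and r :: real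
  assumes "g_quasi_metric X dX r" and "g_quasi_metric Y dY r"
  shows "G_complete (X \<times> Y) (prod_gq_metric dX dY) r \<longleftrightarrow>
         G_complete X dX r \<and> G_complete Y dY r"
proof
  assume complete: "G_complete (X \<times> Y) (prod_gq_metric dX dY) r"
  have limits: "\<exists>a b. gq_converges X dX s a \<and> gq_converges Y dY t b"
    if "\<forall>n. s n \<in> X" "\<forall>n. t n \<in> Y" "G_Cauchy dX r s" "G_Cauchy dY r t" for s t
  proof -
    have "(s n, t n) \<in> X \<times> Y" for n
      using that by simp
    moreover have "G_Cauchy (prod_gq_metric dX dY) r (\<lambda>n. (s n, t n))"
      using that by (simp add: G_Cauchy_prod_iff)
    ultimately obtain c where
      "gq_converges (X \<times> Y) (prod_gq_metric dX dY) (\<lambda>n. (s n, t n)) c"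
      by (rule G_completeE[OF complete])
    then show ?thesis
      by (cases c) (auto simp: gq_converges_prod_iff[OF assms])
  qed
  obtain x0 y0 where x0: "x0 \<in> X" and y0: "y0 \<in> Y"
    using assms by (auto simp: g_quasi_metric_def)
  have "\<exists>a. gq_converges X dX s a" if "\<forall>n. s n \<in> X" "G_Cauchy dX r s" for s
    using limits[of s "\<lambda>n. y0"] that y0 G_Cauchy_const[OF assms(2) y0] by simp
  moreover have "\<exists>b. gq_converges Y dY t b" if "\<forall>n. t n \<in> Y" "G_Cauchy dY r t" for t
    using limits[of "\<lambda>n. x0" t] that x0 G_Cauchy_const[OF assms(1) x0] by simp
  ultimately show "G_complete X dX r \<and> G_complete Y dY r"
    by (simp add: G_complete_iff)
next
  assume complete: "G_complete X dX r \<and> G_complete Y dY r"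
  show "G_complete (X \<times> Y) (prod_gq_metric dX dY) r"
    unfolding G_complete_iff
  proof (intro allI impI)
    fix u :: "nat \<Rightarrow> 'a \<times> 'b"
    assume u: "\<forall>n. u n \<in> X \<times> Y" and Cauchy: "G_Cauchy (prod_gq_metric dX dY) r u"
    define s t where "s = fst \<circ> u" and "t = snd \<circ> u"
    have u_eq: "u = (\<lambda>n. (s n, t n))"
      by (simp add: s_def t_def)
    have in_factors: "s n \<in> X" "t n \<in> Y" for n
      using u by (simp_all add: s_def t_def mem_Times_iff)
    have "G_Cauchy dX r s" "G_Cauchy dY r t"
      using Cauchy unfolding u_eq G_Cauchy_prod_iff by simp_all
    then obtain a b where "gq_converges X dX s a" "gq_converges Y dY t b"
      using G_completeE[of X dX r s] G_completeE[of Y dY r t] complete in_factors by metis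
    then have "gq_converges (X \<times> Y) (prod_gq_metric dX dY) u (a, b)"
      unfolding u_eq gq_converges_prod_iff[OF assms] by simp
    then show "\<exists>c. gq_converges (X \<times> Y) (prod_gq_metric dX dY) u c" ..
  qed
qed

end
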